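(* Let $(X,d)$ be a $1$-bounded pseudometric space and let $A,B\in\mathcal{C}X$. Then \[ d_{HK}(d)(A,B)=K_\lambda(d)(A,B). \]
   Context: $\mathcal{D}X$ is the set of finitely supported probability distributions on $X$ and $\mathbb{E}_\mu[f]=\sum_x\mu(x)f(x)$. $\mathcal{C}X$ is the set of non-empty convex subsets $D\subseteq\mathcal{D}X$ (convex: $p\mu_1+(1-p)\mu_2\in D$ for $\mu_1,\mu_2\in D$, $p\in[0,1]$). The Kantorovich–Wasserstein distance is $d_K(d)(\mu,\nu)=\sup\{\mathbb{E}_\nu[f]-\mathbb{E}_\mu[f]\mid f\colon(X,d)\to([0,1],|\cdot-\cdot|)\text{ nonexpansive}\}$; the Hausdorff distance of a pseudometric $e$ is $d_H(e)(A,B)=\max(\sup_{a\in A}\inf_{b\in B}e(a,b),\sup_{b\in B}\inf_{a\in A}e(a,b))$; and $d_{HK}(d)=d_H(d_K(d))$. The predicate lifting is $\lambda_X(f)(A)=\sup\{\mathbb{E}_\mu[f]\mid\mu\in A\}$ and $K_\lambda(d)(A,B)=\sup\{|\lambda_X(f)(B)-\lambda_X(f)(A)|\mid f\colon(X,d)\to([0,1],|\cdot-\cdot|)\text{ nonexpansive}\}$. *)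

theory Defs
  imports "HOL-Probability.Probability"
begin

definition pseudometric_1bdd :: "'a set \<Rightarrow> ('a \<Rightarrow> 'a \<Rightarrow> real) \<Rightarrow> bool" where
  "pseudometric_1bdd X d \<longleftrightarrow>
     (\<forall>x\<in>X. \<forall>y\<in>X. 0 \<le> d x y \<and> d x y \<le> 1) \<and>
     (\<forall>x\<in>X. d x x = 0) \<and>
     (\<forall>x\<in>X. \<forall>y\<in>X. d x y = d y x) \<and>
     (\<forall>x\<in>X. \<forall>y\<in>X. \<forall>z\<in>X. d x z \<le> d x y + d y z)"

text \<open>Values of such an \<open>f\<close> outside \<open>X\<close> are arbitrary; they do not affect expectations
  with respect to distributions supported in \<open>X\<close>.\<close>

definition nonexp :: "'a set \<Rightarrow> ('a \<Rightarrow> 'a \<Rightarrow> real) \<Rightarrow> ('a \<Rightarrow> real) set" where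
  "nonexp X d = {f. (\<forall>x\<in>X. f x \<in> {0..1}) \<and> (\<forall>x\<in>X. \<forall>y\<in>X. \<bar>f x - f y\<bar> \<le> d x y)}"

definition fin_dists :: "'a set \<Rightarrow> 'a pmf set" where
  "fin_dists X = {\<mu>. finite (set_pmf \<mu>) \<and> set_pmf \<mu> \<subseteq> X}"

abbreviation expect :: "'a pmf \<Rightarrow> ('a \<Rightarrow> real) \<Rightarrow> real" where
  "expect \<mu> f \<equiv> measure_pmf.expectation \<mu> f"

lemma expect_eq_sum:
  assumes "\<mu> \<in> fin_dists X"
  shows "expect \<mu> f = (\<Sum>x\<in>set_pmf \<mu>. pmf \<mu> x * f x)"
  using assms by (subst integral_measure_pmf[of "set_pmf \<mu>"]) (auto simp: fin_dists_def)

definition mix :: "real \<Rightarrow> 'a pmf \<Rightarrow> 'a pmf \<Rightarrow> 'a pmf" where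
  "mix p \<mu> \<nu> = bind_pmf (bernoulli_pmf p) (\<lambda>b. if b then \<mu> else \<nu>)"

lemma pmf_mix:
  assumes "p \<in> {0..1}"
  shows "pmf (mix p \<mu> \<nu>) x = p * pmf \<mu> x + (1 - p) * pmf \<nu> x"
  using assms by (simp add: mix_def pmf_bind mult.commute)

definition convex_dists :: "'a pmf set \<Rightarrow> bool" where
  "convex_dists D \<longleftrightarrow> (\<forall>\<mu>\<in>D. \<forall>\<nu>\<in>D. \<forall>p\<in>{0..1}. mix p \<mu> \<nu> \<in> D)"

definition convex_sets :: "'a set \<Rightarrow> 'a pmf set set" where
  "convex_sets X = {D. D \<noteq> {} \<and> D \<subseteq> fin_dists X \<and> convex_dists D}"

text \<open>The suprema and infima below are taken in \<open>real\<close>. For a 1-bounded pseudometric on \<open>X\<close>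
  and members of \<open>fin_dists X\<close> or \<open>convex_sets X\<close> they range over non-empty subsets of
  \<open>{-1..1}\<close>, so the junk values of \<open>Sup\<close> and \<open>Inf\<close> do not occur.\<close>

definition d_K :: "'a set \<Rightarrow> ('a \<Rightarrow> 'a \<Rightarrow> real) \<Rightarrow> 'a pmf \<Rightarrow> 'a pmf \<Rightarrow> real" where
  "d_K X d \<mu> \<nu> = (SUP f\<in>nonexp X d. expect \<nu> f - expect \<mu> f)"

definition d_H :: "('b \<Rightarrow> 'b \<Rightarrow> real) \<Rightarrow> 'b set \<Rightarrow> 'b set \<Rightarrow> real" where
  "d_H e A B = max (SUP a\<in>A. INF b\<in>B. e a b) (SUP b\<in>B. INF a\<in>A. e a b)"

definition d_HK :: "'a set \<Rightarrow> ('a \<Rightarrow> 'a \<Rightarrow> real) \<Rightarrow> 'a pmf set \<Rightarrow> 'a pmf set \<Rightarrow> real" where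
  "d_HK X d = d_H (d_K X d)"

definition pred_lift :: "('a \<Rightarrow> real) \<Rightarrow> 'a pmf set \<Rightarrow> real" where
  "pred_lift f A = (SUP \<mu>\<in>A. expect \<mu> f)"

definition K_lift :: "'a set \<Rightarrow> ('a \<Rightarrow> 'a \<Rightarrow> real) \<Rightarrow> 'a pmf set \<Rightarrow> 'a pmf set \<Rightarrow> real" where
  "K_lift X d A B = (SUP f\<in>nonexp X d. \<bar>pred_lift f B - pred_lift f A\<bar>)"

end

theory Submission
  imports Defs
begin

text \<open>
  The inequality \<open>K_lift \<le> d_HK\<close> is a direct estimate. For the converse, fix \<open>\<mu> \<in> A\<close>. By symmetry
  of the Kantorovich distance, what is needed is
  \<open>inf\<^sub>\<nu> sup\<^sub>f (E\<^sub>\<mu> f - E\<^sub>\<nu> f) \<le> sup\<^sub>f inf\<^sub>\<nu> (E\<^sub>\<mu> f - E\<^sub>\<nu> f)\<close>,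
  where \<open>\<nu>\<close> ranges over the convex set \<open>B\<close> and \<open>f\<close> over the nonexpansive functions, which form a
  convex set that is compact for pointwise convergence (Tychonoff). This is an instance of a
  minimax theorem: compactness reduces \<open>B\<close> to finitely many points, and these are merged one
  after the other by separating a convex set from a quadrant in the plane.
\<close>

section \<open>A minimax theorem\<close>

text \<open>A line separates \<open>S\<close> from the open quadrant with corner
  \<open>(c, c)\<close>. The quadrant is unbounded in both coordinate directions, so the normal
  \<open>(u, v)\<close> has no negative entry, and scaling it to \<open>u + v = 1\<close> yields the
  weight \<open>t\<close>.\<close>

lemma separate_from_quadrant:
  fixes S :: "(real \<times> real) set"
  assumes "convex S" and "\<And>x y. (x, y) \<in> S \<Longrightarrow> x \<le> c \<or> y \<le> c"
  shows "\<exists>t\<in>{0..1}. \<forall>(x, y)\<in>S. t * x + (1 - t) * y \<le> c"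
proof (cases "S = {}")
  case True
  then show ?thesis by (intro bexI[of _ 0]) auto
next
  case False
  let ?T = "{c<..} \<times> {c<..}"
  have "convex ?T" by (intro convex_Times) auto
  moreover have "?T \<noteq> {}" by (auto intro: gt_ex)
  moreover have "S \<inter> ?T = {}" using assms(2) by fastforce
  ultimately obtain a b where a: "a \<noteq> 0" "\<forall>x\<in>S. inner a x \<le> b" "\<forall>x\<in>?T. inner a x \<ge> b"
    using separating_hyperplane_sets[OF assms(1) _ False] by blast
  obtain u v where uv: "a = (u, v)" by (cases a)
  have T: "b \<le> u * x + v * y" if "x > c" "y > c" for x y
    using a(3) that by (auto simp: uv)
  have S: "u * x + v * y \<le> b" if "(x, y) \<in> S" for x y
    using a(2) that by (auto simp: uv)
  \<comment> \<open>A shift by \<open>(m + 1) / - u\<close> along a coordinate with negative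
    coefficient lowers the functional by \<open>m + 1\<close>, which is enough to push it below
    \<open>b\<close>.\<close>
  define m where "m = \<bar>(u + v) * (c + 1) - b\<bar>"
  have "u \<ge> 0"
  proof (rule ccontr)
    assume "\<not> u \<ge> 0"
    then have "(m + 1) / - u > 0" by (simp add: m_def divide_pos_neg)
    then have "b \<le> u * (c + 1 + (m + 1) / - u) + v * (c + 1)" by (intro T) auto
    also have "\<dots> = (u + v) * (c + 1) - (m + 1)"
      using \<open>\<not> u \<ge> 0\<close> by (simp add: field_simps)
    finally show False unfolding m_def by linarith
  qed
  moreover have "v \<ge> 0"
  proof (rule ccontr)
    assume "\<not> v \<ge> 0"
    then have "(m + 1) / - v > 0" by (simp add: m_def divide_pos_neg)
    then have "b \<le> u * (c + 1) + v * (c + 1 + (m + 1) / - v)" by (intro T) auto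
    also have "\<dots> = (u + v) * (c + 1) - (m + 1)"
      using \<open>\<not> v \<ge> 0\<close> by (simp add: field_simps)
    finally show False unfolding m_def by linarith
  qed
  moreover have "u \<noteq> 0 \<or> v \<noteq> 0" using a(1) by (auto simp: uv zero_prod_def)
  ultimately have pos: "u + v > 0" by linarith
  \<comment> \<open>The corner is only a limit of points of the open quadrant, so it is approached
    along the diagonal.\<close>
  have "b \<le> (u + v) * c"
  proof (rule field_le_epsilon)
    fix e :: real assume "e > 0"
    then have "e / (u + v) > 0" using pos by simp
    then have "b \<le> u * (c + e / (u + v)) + v * (c + e / (u + v))" by (intro T) auto
    also have "\<dots> = (u + v) * c + e"
      using pos by (simp flip: distrib_right) (simp add: distrib_left)
    finally show "b \<le> (u + v) * c + e" .
  qed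
  then have le: "u * x + v * y \<le> c * (u + v)" if "(x, y) \<in> S" for x y
    using S[OF that] by (simp add: mult.commute)
  show ?thesis
  proof (intro bexI[of _ "u / (u + v)"] ballI, clarify)
    fix x y assume "(x, y) \<in> S"
    have "1 - u / (u + v) = v / (u + v)" using pos by (simp add: field_simps)
    then have "u / (u + v) * x + (1 - u / (u + v)) * y = (u * x + v * y) / (u + v)"
      by (simp add: add_divide_distrib)
    also have "\<dots> \<le> c" using le[OF \<open>(x, y) \<in> S\<close>] pos by (simp add: divide_le_eq)
    finally show "u / (u + v) * x + (1 - u / (u + v)) * y \<le> c" .
  qed (use pos \<open>u \<ge> 0\<close> \<open>v \<ge> 0\<close> in auto)
qed

text \<open>Convex combinations are expressed through the values of \<open>\<phi>\<close> alone, so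
  neither argument has to live in a vector space. This matters for distributions, which are not
  closed under addition.\<close>

definition affinelike_left :: "'f set \<Rightarrow> 'b set \<Rightarrow> ('f \<Rightarrow> 'b \<Rightarrow> real) \<Rightarrow> bool" where
  "affinelike_left F B \<phi> \<longleftrightarrow>
     (\<forall>f\<in>F. \<forall>g\<in>F. \<forall>t\<in>{0..1}. \<exists>h\<in>F. \<forall>b\<in>B. \<phi> h b = t * \<phi> f b + (1 - t) * \<phi> g b)"

definition affinelike_right :: "'f set \<Rightarrow> 'b set \<Rightarrow> ('f \<Rightarrow> 'b \<Rightarrow> real) \<Rightarrow> bool" where
  "affinelike_right F B \<phi> \<longleftrightarrow>
     (\<forall>a\<in>B. \<forall>b\<in>B. \<forall>t\<in>{0..1}. \<exists>m\<in>B. \<forall>f\<in>F. \<phi> f m = t * \<phi> f a + (1 - t) * \<phi> f b)"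

text \<open>The value pairs at \<open>a\<close> and \<open>b\<close> form a convex planar set that
  misses the open quadrant. The weight \<open>t\<close> from the separation says which mixture of
  \<open>a\<close> and \<open>b\<close> to take.\<close>

lemma minimax_two:
  assumes left: "affinelike_left F B \<phi>" and right: "affinelike_right F B \<phi>"
    and "a \<in> B" "b \<in> B" and le: "\<And>f. f \<in> F \<Longrightarrow> \<phi> f a \<le> c \<or> \<phi> f b \<le> c"
  shows "\<exists>m\<in>B. \<forall>f\<in>F. \<phi> f m \<le> c"
proof -
  let ?S = "(\<lambda>f. (\<phi> f a, \<phi> f b)) ` F"
  have "convex ?S"
  proof (rule convexI)
    fix x y and u v :: real
    assume "x \<in> ?S" "y \<in> ?S" and uv: "0 \<le> u" "0 \<le> v" "u + v = 1"
    then obtain f g where fg: "f \<in> F" "g \<in> F" "x = (\<phi> f a, \<phi> f b)" "y = (\<phi> g a, \<phi> g b)"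
      by blast
    have v: "v = 1 - u" and u: "u \<in> {0..1}" using uv by auto
    obtain h where h: "h \<in> F" "\<And>b. b \<in> B \<Longrightarrow> \<phi> h b = u * \<phi> f b + (1 - u) * \<phi> g b"
      using left fg(1,2) u unfolding affinelike_left_def by meson
    have "u *\<^sub>R x + v *\<^sub>R y = (\<phi> h a, \<phi> h b)"
      using h(2) \<open>a \<in> B\<close> \<open>b \<in> B\<close> by (simp add: fg v)
    then show "u *\<^sub>R x + v *\<^sub>R y \<in> ?S" using h(1) by blast
  qed
  then obtain t where t: "t \<in> {0..1}" "\<forall>(x, y)\<in>?S. t * x + (1 - t) * y \<le> c"
    using separate_from_quadrant[of ?S c] le by blast
  obtain m where "m \<in> B" "\<forall>f\<in>F. \<phi> f m = t * \<phi> f a + (1 - t) * \<phi> f b"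
    using right \<open>a \<in> B\<close> \<open>b \<in> B\<close> t(1) unfolding affinelike_right_def by meson
  then show ?thesis using t(2) by (intro bexI[of _ m]) auto
qed

lemma minimax_finite:
  assumes "finite I" "I \<noteq> {}" "I \<subseteq> B"
    and "affinelike_left F B \<phi>" and "affinelike_right F B \<phi>"
    and "\<And>f. f \<in> F \<Longrightarrow> \<exists>b\<in>I. \<phi> f b \<le> c"
  shows "\<exists>m\<in>B. \<forall>f\<in>F. \<phi> f m \<le> c"
  using assms
proof (induction I arbitrary: F rule: finite_ne_induct)
  case (singleton b)
  then show ?case by auto
next
  case (insert b I)
  \<comment> \<open>Only where the point \<open>b\<close> fails do the remaining points have to succeed.\<close>
  let ?F = "{f \<in> F. c < \<phi> f b}"
  have b: "b \<in> B" "I \<subseteq> B" using insert.prems(1) by auto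
  have "affinelike_left ?F B \<phi>"
    unfolding affinelike_left_def
  proof (intro ballI)
    fix f g and t :: real assume fg: "f \<in> ?F" "g \<in> ?F" and t: "t \<in> {0..1}"
    then have "f \<in> F" "g \<in> F" by auto
    then obtain h where h: "h \<in> F" "\<forall>b\<in>B. \<phi> h b = t * \<phi> f b + (1 - t) * \<phi> g b"
      using insert.prems(2) t unfolding affinelike_left_def by meson
    have "t * \<phi> f b + (1 - t) * \<phi> g b > c"
      using convex_bound_lt[of "- \<phi> f b" "- c" "- \<phi> g b" t "1 - t"] fg t by simp
    then have "h \<in> ?F" using h b by simp
    then show "\<exists>h\<in>?F. \<forall>b\<in>B. \<phi> h b = t * \<phi> f b + (1 - t) * \<phi> g b" using h(2) by blast
  qed
  moreover have "affinelike_right ?F B \<phi>"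
    using insert.prems(3) unfolding affinelike_right_def by (metis (lifting) mem_Collect_eq)
  moreover have "\<exists>b\<in>I. \<phi> f b \<le> c" if "f \<in> ?F" for f
    using insert.prems(4)[of f] that by auto
  ultimately obtain m where m: "m \<in> B" "\<forall>f\<in>?F. \<phi> f m \<le> c"
    using insert.IH[OF b(2)] by blast
  \<comment> \<open>Each function of \<open>F\<close> meets the bound at \<open>b\<close> or lies in
    \<open>?F\<close>, where \<open>m\<close> meets it; so \<open>b\<close> and \<open>m\<close> can
    be merged.\<close>
  show ?case
    by (rule minimax_two[OF insert.prems(2,3) b(1) m(1)]) (use m(2) in force)
qed

text \<open>The strict hypothesis makes the sets \<open>{f. \<phi> f b < c}\<close> open; they cover
  \<open>F\<close>, and a finite subcover reduces the claim to finitely many points of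
  \<open>B\<close>.\<close>

theorem minimax_compact:
  fixes F :: "'f::topological_space set"
  assumes "compact F" and "B \<noteq> {}"
    and left: "affinelike_left F B \<phi>" and right: "affinelike_right F B \<phi>"
    and cont: "\<And>b. b \<in> B \<Longrightarrow> continuous_on UNIV (\<lambda>f. \<phi> f b)"
    and less: "\<And>f. f \<in> F \<Longrightarrow> \<exists>b\<in>B. \<phi> f b < c"
  shows "\<exists>m\<in>B. \<forall>f\<in>F. \<phi> f m \<le> c"
proof -
  have "open {f. \<phi> f b < c}" if "b \<in> B" for b
    using cont[OF that] by (intro open_Collect_less) auto
  moreover have "F \<subseteq> (\<Union>b\<in>B. {f. \<phi> f b < c})" using less by auto
  ultimately obtain I where I: "I \<subseteq> B" "finite I" "F \<subseteq> (\<Union>b\<in>I. {f. \<phi> f b < c})"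
    using compactE_image[OF \<open>compact F\<close>] by metis
  \<comment> \<open>If \<open>F\<close> is empty, the subcover \<open>I\<close> may be empty; adding
    \<open>b\<close> keeps the index set non-empty.\<close>
  obtain b where b: "b \<in> B" using \<open>B \<noteq> {}\<close> by blast
  show ?thesis
    by (rule minimax_finite[of "insert b I" B F]) (use I b left right in \<open>auto intro: less_imp_le\<close>)
qed

section \<open>Expectations of nonexpansive functions\<close>

lemma expect_mix:
  assumes "\<mu> \<in> fin_dists X" "\<nu> \<in> fin_dists X" "p \<in> {0..1}"
  shows "expect (mix p \<mu> \<nu>) f = p * expect \<mu> f + (1 - p) * expect \<nu> f"
proof -
  \<comment> \<open>A common finite index set for all three expectations; the support of the mixture
    can be smaller when \<open>p\<close> is 0 or 1.\<close>
  let ?S = "set_pmf \<mu> \<union> set_pmf \<nu>"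
  have fin: "finite ?S" using assms by (auto simp: fin_dists_def)
  have exp: "expect \<rho> f = (\<Sum>x\<in>?S. pmf \<rho> x * f x)" if "set_pmf \<rho> \<subseteq> ?S" for \<rho>
    using that by (subst integral_measure_pmf[OF fin]) auto
  have "set_pmf (mix p \<mu> \<nu>) \<subseteq> ?S" by (auto simp: mix_def split: if_splits)
  then show ?thesis
    by (simp add: exp pmf_mix[OF assms(3)] sum_distrib_left sum.distrib distrib_right mult.assoc)
qed

lemma expect_cong:
  assumes "\<mu> \<in> fin_dists X" "\<And>x. x \<in> X \<Longrightarrow> f x = g x"
  shows "expect \<mu> f = expect \<mu> g"
  using assms by (auto simp: expect_eq_sum[OF assms(1)] fin_dists_def intro!: sum.cong)

lemma expect_affine:
  assumes "\<mu> \<in> fin_dists X"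
  shows "expect \<mu> (\<lambda>x. s * f x + t * g x) = s * expect \<mu> f + t * expect \<mu> g"
  by (simp add: expect_eq_sum[OF assms] sum_distrib_left sum.distrib algebra_simps)

lemma expect_compl:
  assumes "\<mu> \<in> fin_dists X"
  shows "expect \<mu> (\<lambda>x. 1 - f x) = 1 - expect \<mu> f"
  using expect_affine[OF assms, of 1 "\<lambda>_. 1" "- 1" f] by simp

lemma expect_bounds:
  assumes "\<mu> \<in> fin_dists X" "f \<in> nonexp X d"
  shows "expect \<mu> f \<in> {0..1}"
proof -
  have sub: "f x \<in> {0..1}" if "x \<in> set_pmf \<mu>" for x
    using assms that by (auto simp: fin_dists_def nonexp_def)
  have fin: "finite (set_pmf \<mu>)" using assms(1) by (simp add: fin_dists_def)
  have "expect \<mu> f \<le> (\<Sum>x\<in>set_pmf \<mu>. pmf \<mu> x * 1)"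
    unfolding expect_eq_sum[OF assms(1)] using sub by (intro sum_mono mult_left_mono) auto
  also have "\<dots> = 1" using sum_pmf_eq_1[OF fin] by simp
  moreover have "0 \<le> expect \<mu> f"
    unfolding expect_eq_sum[OF assms(1)] using sub by (intro sum_nonneg mult_nonneg_nonneg) auto
  ultimately show ?thesis by simp
qed

text \<open>This reflection reverses the sign of a difference of expectations, which makes
  \<open>d_K\<close> symmetric although its definition has no absolute value.\<close>

lemma nonexp_compl: "f \<in> nonexp X d \<Longrightarrow> (\<lambda>x. 1 - f x) \<in> nonexp X d"
  by (auto simp: nonexp_def abs_minus_commute)

lemma nonexp_convex:
  assumes "f \<in> nonexp X d" "g \<in> nonexp X d" "t \<in> {0..1}"
  shows "(\<lambda>x. t * f x + (1 - t) * g x) \<in> nonexp X d"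
  unfolding nonexp_def
proof (intro CollectI conjI ballI)
  have t: "0 \<le> t" "0 \<le> 1 - t" using assms(3) by auto
  fix x assume x: "x \<in> X"
  then have fg: "f x \<in> {0..1}" "g x \<in> {0..1}" using assms by (auto simp: nonexp_def)
  then show "t * f x + (1 - t) * g x \<in> {0..1}"
    using t convex_bound_le[of "f x" 1 "g x" t "1 - t"] by simp
  fix y assume y: "y \<in> X"
  have le: "\<bar>f x - f y\<bar> \<le> d x y" "\<bar>g x - g y\<bar> \<le> d x y"
    using assms x y by (auto simp: nonexp_def)
  have "\<bar>t * f x + (1 - t) * g x - (t * f y + (1 - t) * g y)\<bar>
      = \<bar>t * (f x - f y) + (1 - t) * (g x - g y)\<bar>"
    by (simp add: algebra_simps)
  also have "\<dots> \<le> t * \<bar>f x - f y\<bar> + (1 - t) * \<bar>g x - g y\<bar>"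
    using t by (intro order_trans[OF abs_triangle_ineq]) (simp add: abs_mult)
  also have "\<dots> \<le> d x y" using t le by (intro convex_bound_le) auto
  finally show "\<bar>t * f x + (1 - t) * g x - (t * f y + (1 - t) * g y)\<bar> \<le> d x y" .
qed

text \<open>Keeps the suprema over \<open>nonexp X d\<close> non-empty and witnesses that
  \<open>d_K\<close> is nonnegative.\<close>

lemma zero_nonexp:
  assumes "pseudometric_1bdd X d"
  shows "(\<lambda>_. 0) \<in> nonexp X d"
  using assms by (auto simp: nonexp_def pseudometric_1bdd_def)

text \<open>Values outside \<open>X\<close> have to be bounded too for the set of nonexpansive functions to be compact.\<close>

lemma compact_nonexp: "compact (nonexp X d \<inter> (UNIV \<rightarrow>\<^sub>E {0..1}))"
proof (rule closed_Int_compact)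
  have "compactin (product_topology (\<lambda>_. euclidean) UNIV) (UNIV \<rightarrow>\<^sub>E {0..1::real} :: ('a \<Rightarrow> real) set)"
    by (subst compactin_PiE) auto
  then show "compact (UNIV \<rightarrow>\<^sub>E {0..1::real} :: ('a \<Rightarrow> real) set)"
    by (simp add: euclidean_product_topology)
  have coord: "continuous_on UNIV (\<lambda>f::'a \<Rightarrow> real. f x)" for x
    by (rule continuous_on_product_coordinates)
  \<comment> \<open>Each condition involves at most two coordinates, hence is closed for pointwise
    convergence.\<close>
  have "nonexp X d = (\<Inter>x\<in>X. {f. 0 \<le> f x} \<inter> {f. f x \<le> 1} \<inter> (\<Inter>y\<in>X. {f. \<bar>f x - f y\<bar> \<le> d x y}))"
    by (auto simp: nonexp_def)
  also have "closed \<dots>"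
    by (intro closed_INT closed_Int ballI closed_Collect_le continuous_intros coord)
  finally show "closed (nonexp X d)" .
qed

section \<open>The Kantorovich distance and the predicate lifting\<close>

lemma expect_diff_le_d_K:
  assumes "\<mu> \<in> fin_dists X" "\<nu> \<in> fin_dists X" "f \<in> nonexp X d"
  shows "expect \<nu> f - expect \<mu> f \<le> d_K X d \<mu> \<nu>"
  unfolding d_K_def
proof (rule cSUP_upper[OF assms(3)], rule bdd_aboveI2)
  fix g assume "g \<in> nonexp X d"
  then show "expect \<nu> g - expect \<mu> g \<le> 1"
    using expect_bounds[OF assms(1)] expect_bounds[OF assms(2)] by fastforce
qed

lemma d_K_le:
  assumes "pseudometric_1bdd X d" "\<And>f. f \<in> nonexp X d \<Longrightarrow> expect \<nu> f - expect \<mu> f \<le> c"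
  shows "d_K X d \<mu> \<nu> \<le> c"
  unfolding d_K_def using zero_nonexp[OF assms(1)] assms(2) by (intro cSUP_least) auto

lemma d_K_commute:
  assumes "pseudometric_1bdd X d" "\<mu> \<in> fin_dists X" "\<nu> \<in> fin_dists X"
  shows "d_K X d \<mu> \<nu> = d_K X d \<nu> \<mu>"
proof -
  have "d_K X d \<mu> \<nu> \<le> d_K X d \<nu> \<mu>" if "\<mu> \<in> fin_dists X" "\<nu> \<in> fin_dists X" for \<mu> \<nu>
  proof (rule d_K_le[OF assms(1)])
    fix f assume "f \<in> nonexp X d"
    then show "expect \<nu> f - expect \<mu> f \<le> d_K X d \<nu> \<mu>"
      using expect_diff_le_d_K[OF that(2,1) nonexp_compl] that by (simp add: expect_compl)
  qed
  then show ?thesis using assms by (intro antisym) auto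
qed

lemma d_K_bounds:
  assumes "pseudometric_1bdd X d" "\<mu> \<in> fin_dists X" "\<nu> \<in> fin_dists X"
  shows "d_K X d \<mu> \<nu> \<in> {0..1}"
proof -
  have "expect \<nu> f - expect \<mu> f \<le> 1" if "f \<in> nonexp X d" for f
    using expect_bounds[OF assms(2) that] expect_bounds[OF assms(3) that] by simp
  then have "d_K X d \<mu> \<nu> \<le> 1" by (rule d_K_le[OF assms(1)])
  then show ?thesis using expect_diff_le_d_K[OF assms(2,3) zero_nonexp[OF assms(1)]] by simp
qed

lemma bdd_below_d_K:
  assumes "pseudometric_1bdd X d" "B \<subseteq> fin_dists X" "\<mu> \<in> fin_dists X"
  shows "bdd_below (d_K X d \<mu> ` B)"
  using d_K_bounds[OF assms(1,3)] assms(2) by (intro bdd_belowI2[of _ 0]) auto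

lemma expect_le_pred_lift:
  assumes "A \<subseteq> fin_dists X" "f \<in> nonexp X d" "\<mu> \<in> A"
  shows "expect \<mu> f \<le> pred_lift f A"
  unfolding pred_lift_def using expect_bounds[OF _ assms(2)] assms(1)
  by (intro cSUP_upper[OF assms(3)] bdd_aboveI2[of _ _ 1]) auto

lemma pred_lift_bounds:
  assumes "A \<subseteq> fin_dists X" "A \<noteq> {}" "f \<in> nonexp X d"
  shows "pred_lift f A \<in> {0..1}"
proof -
  obtain \<mu> where \<mu>: "\<mu> \<in> A" using assms(2) by blast
  have "pred_lift f A \<le> 1"
    unfolding pred_lift_def using expect_bounds[OF _ assms(3)] assms(1)
    by (intro cSUP_least[OF assms(2)]) auto
  moreover have "0 \<le> expect \<mu> f" using expect_bounds[OF _ assms(3)] assms(1) \<mu> by auto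
  ultimately show ?thesis using expect_le_pred_lift[OF assms(1,3) \<mu>] by simp
qed

text \<open>Each \<open>\<mu>\<close> in \<open>A\<close> has a nearly closest \<open>\<nu>\<close>
  in \<open>B\<close>, and their expectations of \<open>f\<close> differ by at most their distance.
  The slack \<open>e\<close> is there because the infimum need not be attained.\<close>

lemma pred_lift_le_of_d_K:
  assumes d: "pseudometric_1bdd X d" and A: "A \<in> convex_sets X" and B: "B \<in> convex_sets X"
    and f: "f \<in> nonexp X d" and H: "\<And>\<mu>. \<mu> \<in> A \<Longrightarrow> (INF \<nu>\<in>B. d_K X d \<mu> \<nu>) \<le> H"
  shows "pred_lift f A \<le> pred_lift f B + H"
proof -
  have sub: "A \<subseteq> fin_dists X" "B \<subseteq> fin_dists X" "A \<noteq> {}" "B \<noteq> {}"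
    using A B by (auto simp: convex_sets_def)
  have "expect \<mu> f \<le> pred_lift f B + H" if \<mu>: "\<mu> \<in> A" for \<mu>
  proof (rule field_le_epsilon)
    fix e :: real assume "e > 0"
    have \<mu>X: "\<mu> \<in> fin_dists X" using \<mu> sub by auto
    have "(INF \<nu>\<in>B. d_K X d \<mu> \<nu>) < H + e" using H[OF \<mu>] \<open>e > 0\<close> by simp
    then obtain \<nu> where \<nu>: "\<nu> \<in> B" "d_K X d \<mu> \<nu> < H + e"
      using cINF_less_iff[OF sub(4) bdd_below_d_K[OF d sub(2) \<mu>X]] by blast
    then have \<nu>X: "\<nu> \<in> fin_dists X" using sub by auto
    have "expect \<mu> f - expect \<nu> f \<le> d_K X d \<mu> \<nu>"
      using expect_diff_le_d_K[OF \<nu>X \<mu>X f] d_K_commute[OF d \<mu>X \<nu>X] by simp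
    then show "expect \<mu> f \<le> pred_lift f B + H + e"
      using expect_le_pred_lift[OF sub(2) f \<nu>(1)] \<nu>(2) by simp
  qed
  then show ?thesis by (subst pred_lift_def) (intro cSUP_least[OF sub(3)])
qed

text \<open>The hypothesis supplies for each \<open>f\<close> its own \<open>\<nu>\<close> with
  \<open>expect \<mu> f - expect \<nu> f < K + e\<close>. Minimax exchanges the quantifiers and
  gives one \<open>\<nu>\<close> for all \<open>f\<close>, which is then within \<open>K + e\<close>
  of \<open>\<mu>\<close>.\<close>

lemma INF_d_K_le_of_pred_lift:
  assumes d: "pseudometric_1bdd X d" and A: "A \<in> convex_sets X" and B: "B \<in> convex_sets X"
    and \<mu>: "\<mu> \<in> A" and K: "\<And>f. f \<in> nonexp X d \<Longrightarrow> pred_lift f A \<le> pred_lift f B + K"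
  shows "(INF \<nu>\<in>B. d_K X d \<mu> \<nu>) \<le> K"
proof (rule field_le_epsilon)
  fix e :: real assume "e > 0"
  have sub: "A \<subseteq> fin_dists X" "B \<subseteq> fin_dists X" "B \<noteq> {}"
    using A B by (auto simp: convex_sets_def)
  then have \<mu>X: "\<mu> \<in> fin_dists X" using \<mu> by auto
  let ?F = "nonexp X d \<inter> (UNIV \<rightarrow>\<^sub>E {0..1})"
  let ?\<phi> = "\<lambda>f \<nu>. expect \<mu> f - expect \<nu> f"
  have "\<exists>\<nu>\<in>B. \<forall>f\<in>?F. ?\<phi> f \<nu> \<le> K + e"
  proof (rule minimax_compact[OF compact_nonexp sub(3)])
    show "affinelike_left ?F B ?\<phi>"
      unfolding affinelike_left_def
    proof (intro ballI)
      fix f g and t :: real assume f: "f \<in> ?F" and g: "g \<in> ?F" and t: "t \<in> {0..1}"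
      let ?h = "\<lambda>x. t * f x + (1 - t) * g x"
      have "?h x \<in> {0..1}" for x
      proof -
        have "f x \<in> {0..1}" "g x \<in> {0..1}" using f g by auto
        then show ?thesis using t convex_bound_le[of "f x" 1 "g x" t "1 - t"] by simp
      qed
      then have "?h \<in> ?F" using nonexp_convex[of f X d g t] f g t by auto
      moreover have "?\<phi> ?h \<nu> = t * ?\<phi> f \<nu> + (1 - t) * ?\<phi> g \<nu>" if "\<nu> \<in> B" for \<nu>
      proof -
        have "\<nu> \<in> fin_dists X" using that sub by auto
        then show ?thesis
          unfolding expect_affine[OF \<mu>X] expect_affine[OF \<open>\<nu> \<in> fin_dists X\<close>]
          by (simp add: algebra_simps)
      qed
      ultimately show "\<exists>h\<in>?F. \<forall>\<nu>\<in>B. ?\<phi> h \<nu> = t * ?\<phi> f \<nu> + (1 - t) * ?\<phi> g \<nu>" by blast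
    qed
    show "affinelike_right ?F B ?\<phi>"
      unfolding affinelike_right_def
    proof (intro ballI)
      fix \<nu> \<nu>' and t :: real assume \<nu>: "\<nu> \<in> B" "\<nu>' \<in> B" and t: "t \<in> {0..1}"
      then have "mix t \<nu> \<nu>' \<in> B" using B by (auto simp: convex_sets_def convex_dists_def)
      moreover have "expect (mix t \<nu> \<nu>') f = t * expect \<nu> f + (1 - t) * expect \<nu>' f" for f
        using \<nu> t sub by (intro expect_mix[of _ X]) auto
      ultimately show "\<exists>m\<in>B. \<forall>f\<in>?F. ?\<phi> f m = t * ?\<phi> f \<nu> + (1 - t) * ?\<phi> f \<nu>'"
        by (intro bexI[of _ "mix t \<nu> \<nu>'"]) (auto simp: algebra_simps)
    qed
    show "continuous_on UNIV (\<lambda>f. ?\<phi> f \<nu>)" if "\<nu> \<in> B" for \<nu>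
    proof -
      have \<nu>: "\<nu> \<in> fin_dists X" using that sub by auto
      \<comment> \<open>Finite supports turn both expectations into finite sums of coordinates of
        \<open>f\<close>.\<close>
      show ?thesis unfolding expect_eq_sum[OF \<mu>X] expect_eq_sum[OF \<nu>]
        by (intro continuous_intros continuous_on_product_coordinates)
    qed
    show "\<exists>\<nu>\<in>B. ?\<phi> f \<nu> < K + e" if "f \<in> ?F" for f
    proof -
      have f: "f \<in> nonexp X d" using that by simp
      have bdd: "bdd_above ((\<lambda>\<nu>. expect \<nu> f) ` B)"
        using expect_bounds[OF _ f] sub(2) by (intro bdd_aboveI2[of _ _ 1]) auto
      \<comment> \<open>The positive \<open>e\<close> makes this strict, so some member of
        \<open>B\<close> already exceeds the left side even if the supremum is not attained.\<close>
      have "expect \<mu> f - (K + e) < pred_lift f B"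
        using expect_le_pred_lift[OF sub(1) f \<mu>] K[OF f] \<open>e > 0\<close> by simp
      then show ?thesis
        using less_cSUP_iff[OF sub(3) bdd] unfolding pred_lift_def by fastforce
    qed
  qed
  then obtain \<nu> where \<nu>: "\<nu> \<in> B" "\<And>f. f \<in> ?F \<Longrightarrow> ?\<phi> f \<nu> \<le> K + e" by blast
  then have \<nu>X: "\<nu> \<in> fin_dists X" using sub by auto
  have "d_K X d \<nu> \<mu> \<le> K + e"
  proof (rule d_K_le[OF d])
    fix f assume f: "f \<in> nonexp X d"
    \<comment> \<open>Resetting \<open>f\<close> outside \<open>X\<close> moves it into the compact
      set \<open>?F\<close> without changing expectations, since the supports lie in
      \<open>X\<close>.\<close>
    let ?g = "\<lambda>x. if x \<in> X then f x else 0"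
    have "?g \<in> ?F" using f by (auto simp: nonexp_def)
    moreover have "?\<phi> ?g \<nu> = ?\<phi> f \<nu>"
      using expect_cong[OF \<mu>X, of ?g f] expect_cong[OF \<nu>X, of ?g f] by simp
    ultimately show "?\<phi> f \<nu> \<le> K + e" using \<nu>(2)[of ?g] by simp
  qed
  then have "d_K X d \<mu> \<nu> \<le> K + e" using d_K_commute[OF d \<mu>X \<nu>X] by simp
  then show "(INF \<nu>\<in>B. d_K X d \<mu> \<nu>) \<le> K + e"
    using cINF_lower2[OF bdd_below_d_K[OF d sub(2) \<mu>X] \<nu>(1)] by blast
qed

lemma INF_d_K_le_1:
  assumes "pseudometric_1bdd X d" "B \<subseteq> fin_dists X" "B \<noteq> {}" "\<mu> \<in> fin_dists X"
  shows "(INF \<nu>\<in>B. d_K X d \<mu> \<nu>) \<le> 1"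
proof -
  obtain \<nu> where \<nu>: "\<nu> \<in> B" using assms(3) by blast
  then have "d_K X d \<mu> \<nu> \<le> 1" using d_K_bounds[OF assms(1,4)] assms(2) by auto
  then show ?thesis using cINF_lower2[OF bdd_below_d_K[OF assms(1,2,4)] \<nu>] by blast
qed

theorem theorem3:
  fixes X :: "'a set" and d :: "'a \<Rightarrow> 'a \<Rightarrow> real" and A B :: "'a pmf set"
  assumes "pseudometric_1bdd X d"
    and "A \<in> convex_sets X" and "B \<in> convex_sets X"
  shows "d_HK X d A B = K_lift X d A B"
proof -
  have sub: "A \<subseteq> fin_dists X" "B \<subseteq> fin_dists X" "A \<noteq> {}" "B \<noteq> {}"
    using assms(2,3) by (auto simp: convex_sets_def)
  let ?AB = "SUP \<mu>\<in>A. INF \<nu>\<in>B. d_K X d \<mu> \<nu>"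
  let ?BA = "SUP \<nu>\<in>B. INF \<mu>\<in>A. d_K X d \<nu> \<mu>"
  \<comment> \<open>Symmetry turns the second half of the Hausdorff distance into the first half
    with \<open>A\<close> and \<open>B\<close> exchanged, so each one-sided lemma serves both
    halves.\<close>
  have "(INF \<mu>\<in>A. d_K X d \<mu> \<nu>) = (INF \<mu>\<in>A. d_K X d \<nu> \<mu>)" if "\<nu> \<in> B" for \<nu>
    using that sub by (intro INF_cong refl d_K_commute[OF assms(1)]) auto
  then have HK: "d_HK X d A B = max ?AB ?BA"
    unfolding d_HK_def d_H_def by (simp cong: SUP_cong)
  show ?thesis
  proof (rule antisym)
    have le: "\<bar>pred_lift f B - pred_lift f A\<bar> \<le> K_lift X d A B" if "f \<in> nonexp X d" for f
      unfolding K_lift_def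
    proof (rule cSUP_upper[OF that], rule bdd_aboveI2)
      fix g assume "g \<in> nonexp X d"
      then show "\<bar>pred_lift g B - pred_lift g A\<bar> \<le> 1"
        using pred_lift_bounds[of A X g d] pred_lift_bounds[of B X g d] sub by auto
    qed
    have "?AB \<le> K_lift X d A B"
      using le by (intro cSUP_least[OF sub(3)] INF_d_K_le_of_pred_lift[OF assms(1-3)]) fastforce+
    moreover have "?BA \<le> K_lift X d A B"
      using le by (intro cSUP_least[OF sub(4)] INF_d_K_le_of_pred_lift[OF assms(1,3,2)]) fastforce+
    ultimately show "d_HK X d A B \<le> K_lift X d A B" by (simp add: HK)
  next
    have "(INF \<nu>\<in>B. d_K X d \<mu> \<nu>) \<le> ?AB" if "\<mu> \<in> A" for \<mu>
      using INF_d_K_le_1[OF assms(1) sub(2,4)] sub(1) that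
      by (intro cSUP_upper bdd_aboveI2[of _ _ 1]) auto
    then have AB: "pred_lift f A \<le> pred_lift f B + ?AB" if "f \<in> nonexp X d" for f
      using pred_lift_le_of_d_K[OF assms that] by blast
    have "(INF \<mu>\<in>A. d_K X d \<nu> \<mu>) \<le> ?BA" if "\<nu> \<in> B" for \<nu>
      using INF_d_K_le_1[OF assms(1) sub(1,3)] sub(2) that
      by (intro cSUP_upper bdd_aboveI2[of _ _ 1]) auto
    then have BA: "pred_lift f B \<le> pred_lift f A + ?BA" if "f \<in> nonexp X d" for f
      using pred_lift_le_of_d_K[OF assms(1,3,2) that] by blast
    have "\<bar>pred_lift f B - pred_lift f A\<bar> \<le> max ?AB ?BA" if "f \<in> nonexp X d" for f
      using AB[OF that] BA[OF that] by linarith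
    then show "K_lift X d A B \<le> d_HK X d A B"
      unfolding HK K_lift_def using zero_nonexp[OF assms(1)] by (intro cSUP_least) auto
  qed
qed

end
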